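(* Let $r$ and $n$ be positive integers. The set of $n\times n$ dissimilarity matrices of star tree rank at most $r$ has dimension $\min\left\{\binom{n+1}{2}-\binom{n-r+1}{2},\ \binom{n}{2}\right\}$.
   Context: An $n\times n$ dissimilarity matrix is a function from 2-element subsets of $[n]$ to $\mathbb{R}$ (so the space of them is $\mathbb{R}^{\binom n2}$). A star tree matrix is one of the form $(v_i+v_j)_{i\ne j}$ for $v\in\mathbb{R}^n$; the star tree rank of $M$ is the least $r$ such that $M$ is the entrywise minimum of $r$ star tree matrices. The set of matrices of star tree rank at most $r$ is a finite union of polyhedral cones; its dimension is the maximal dimension of such a cone. Convention: $\binom{m}{2}=0$ for $m<2$. *)

theory Defs
  imports "HOL-Analysis.Analysis"
begin

text \<open>
  The index set \<open>[n]\<close> is a finite type \<open>'n\<close> with \<open>n = CARD('n)\<close>. A function from the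
  2-element subsets of \<open>[n]\<close> to the reals is extended by 0 to all subsets of \<open>[n]\<close>; this embeds the
  space of dissimilarity matrices as a coordinate subspace of dimension \<open>n choose 2\<close>
  in the Euclidean space \<open>real ^ ('n set)\<close>.
\<close>

definition dissimilarity_matrix :: "real ^ ('n::finite set) \<Rightarrow> bool" where
  "dissimilarity_matrix M \<longleftrightarrow> (\<forall>e. card e \<noteq> 2 \<longrightarrow> M $ e = 0)"

definition star_tree_matrix :: "real ^ ('n::finite set) \<Rightarrow> bool" where
  "star_tree_matrix M \<longleftrightarrow> dissimilarity_matrix M \<and>
     (\<exists>v :: real ^ 'n. \<forall>i j. i \<noteq> j \<longrightarrow> M $ {i, j} = v $ i + v $ j)"

text \<open>The minimum of an empty family is not defined, hence \<open>r > 0\<close>.\<close>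

definition min_of_star_trees :: "nat \<Rightarrow> real ^ ('n::finite set) \<Rightarrow> bool" where
  "min_of_star_trees r M \<longleftrightarrow> r > 0 \<and>
     (\<exists>S :: nat \<Rightarrow> real ^ ('n set). (\<forall>k<r. star_tree_matrix (S k)) \<and>
        (\<forall>e. M $ e = Min ((\<lambda>k. S k $ e) ` {..<r})))"

text \<open>
  The least element always exists for a dissimilarity matrix \<open>M\<close>: for each pair \<open>{i, j}\<close> take the
  star tree matrix with \<open>v $ i = v $ j = M $ {i, j} / 2\<close> and all other entries of \<open>v\<close>
  sufficiently large; the minimum of these matrices is \<open>M\<close> (if \<open>n = 1\<close> there is no pair
  and \<open>M = 0\<close> is itself a star tree matrix).
\<close>

definition star_tree_rank :: "real ^ ('n::finite set) \<Rightarrow> nat" where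
  "star_tree_rank M = (LEAST r. min_of_star_trees r M)"

definition cone_decomposition :: "'a::euclidean_space set set \<Rightarrow> 'a set \<Rightarrow> bool" where
  "cone_decomposition F X \<longleftrightarrow>
     finite F \<and> F \<noteq> {} \<and> (\<forall>C\<in>F. polyhedron C \<and> cone C) \<and> \<Union>F = X"

text \<open>
  \<open>X\<close> is a finite union of polyhedral cones, and the maximal dimension of a cone is \<open>d\<close>,
  whichever decomposition is chosen.
\<close>

definition has_cone_dimension :: "'a::euclidean_space set \<Rightarrow> int \<Rightarrow> bool" where
  "has_cone_dimension X d \<longleftrightarrow>
     (\<exists>F. cone_decomposition F X) \<and>
     (\<forall>F. cone_decomposition F X \<longrightarrow> Max (aff_dim ` F) = d)"

end

theory Submission
  imports Defs
begin

text \<open>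
  Fix which tree attains the minimum at each edge. The conditions on the matrix then separate into
  one linear system per tree, so the matrices of rank at most \<open>r\<close> form a finite union of projections
  of polyhedral cones.

  Upper bound: after an infinitesimal shift of the \<open>l\<close>-th tree by a multiple of \<open>l\<close> the minima are strict.
  Each cell then spans a space that is the limit for \<open>s \<rightarrow> \<infinity>\<close>, after rescaling rows and columns, of the image
  of the differential of \<open>X \<mapsto> X X\<^sup>T\<close> (off the diagonal) at the matrix \<open>X\<close> with columns \<open>exp (- s v\<^sub>l)\<close>.
  This image is spanned by the symmetric products \<open>x y\<close> with \<open>x\<close> in an at most \<open>r\<close>-dimensional space, and
  rank can only drop in the limit.

  Lower bound: choose \<open>r\<close> vertices; the cell of the \<open>k\<close>-th tree is the star at the \<open>k\<close>-th vertex together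
  with one extra edge that avoids all chosen vertices, with distinct extra edges as long as there are any left.
\<close>

section \<open>Convex cones, dimensions and binomial coefficients\<close>

text \<open>Every point of \<open>S\<close> can be rescaled into the unit box, so \<open>S\<close>
  is generated as a cone by the finitely many points whose hull is its intersection with the box. A
  linear map sends generators to generators, and a finitely generated convex cone is
  polyhedral.\<close>

lemma polyhedron_linear_image_cone:
  fixes f :: "'a::euclidean_space \<Rightarrow> 'b::euclidean_space"
  assumes "linear f" "polyhedron S" "convex_cone S"
  shows "polyhedron (f ` S)"
proof -
  let ?Q = "S \<inter> cbox (- One) One"
  have "polytope ?Q"
    by (simp add: assms(2) polyhedron_Int_polytope polytope_interval)
  then obtain V where V: "finite V" "?Q = convex hull V"
    unfolding polytope_def by blast
  have "x \<in> convex_cone hull V" if "x \<in> S" for x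
  proof (cases "x = 0")
    case True
    then show ?thesis by (simp add: convex_cone_hull_contains_0)
  next
    case False
    let ?y = "inverse (norm x) *\<^sub>R x"
    have "\<bar>?y \<bullet> b\<bar> \<le> 1" if "b \<in> Basis" for b
      using Basis_le_norm[OF that, of ?y] False by simp
    then have "?y \<in> cbox (- One) One"
      by (auto simp: mem_box abs_le_iff)
    moreover have "?y \<in> S"
      using assms(3) that by (simp add: convex_cone_def conic_def)
    ultimately have "?y \<in> convex_cone hull V"
      using V(2) convex_hull_subset_convex_cone_hull by blast
    then have "norm x *\<^sub>R ?y \<in> convex_cone hull V"
      by (rule convex_cone_hull_mul) simp
    then show ?thesis using False by simp
  qed
  moreover have "convex_cone hull V \<subseteq> S"
    using V(2) assms(3) hull_subset[of V convex] by (intro hull_minimal) auto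
  ultimately have "S = convex_cone hull V" by blast
  then have "f ` S = convex_cone hull (f ` V)"
    using assms(1) by (simp add: convex_cone_hull_linear_image)
  then show ?thesis
    using V(1) by (simp add: polyhedron_convex_cone_hull)
qed

lemma convex_subset_finite_Union_affine:
  fixes C :: "'a::euclidean_space set"
  assumes "finite F" "convex C" "C \<noteq> {}" "C \<subseteq> \<Union>F" "\<And>V. V \<in> F \<Longrightarrow> affine V"
  shows "\<exists>V\<in>F. C \<subseteq> V"
  using assms
proof (induction F)
  case empty
  then show ?case by auto
next
  case (insert V F)
  show ?case
  proof (cases "C \<subseteq> V")
    case False
    then obtain x where x: "x \<in> C" "x \<notin> V" by auto
    have closed: "closed (\<Union>F)"
      using insert by (intro closed_Union) (auto simp: affine_imp_polyhedron polyhedron_imp_closed)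
    have "y \<in> \<Union>F" if "y \<in> C" for y
    proof (cases "y \<in> V")
      case True
      define p where "p k = y + inverse (real (Suc k)) *\<^sub>R (x - y)" for k
      have notV: "p k \<notin> V" for k
      proof
        assume "p k \<in> V"
        \<comment> \<open>The line through \<open>y\<close> and \<open>p k\<close> passes through
          \<open>x\<close>, which lies outside \<open>V\<close>.\<close>
        have "x = (1 - (real (Suc k))) *\<^sub>R y + (real (Suc k)) *\<^sub>R p k"
          by (simp add: p_def scaleR_right_distrib scaleR_left_diff_distrib del: of_nat_Suc)
        also have "\<dots> \<in> V"
          using insert.prems(4)[of V] True \<open>p k \<in> V\<close> by (intro mem_affine) auto
        finally show False using x by simp
      qed
      have "p k \<in> C" for k
      proof -
        have "p k = (1 - inverse (real (Suc k))) *\<^sub>R y + inverse (real (Suc k)) *\<^sub>R x"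
          by (simp add: p_def algebra_simps del: of_nat_Suc)
        then show ?thesis
          using insert.prems(1) x that by (simp add: convexD_alt inverse_le_1_iff)
      qed
      then have "p k \<in> \<Union>F" for k
        using notV[of k] insert.prems(3) by blast
      moreover have "p \<longlonglongrightarrow> y + 0 *\<^sub>R (x - y)"
        unfolding p_def by (intro tendsto_intros LIMSEQ_inverse_real_of_nat)
      ultimately show ?thesis
        using closed closed_sequentially[of "\<Union>F" p] by auto
    qed (use that insert.prems(3) in auto)
    then have "C \<subseteq> \<Union>F" by blast
    then have "\<exists>V\<in>F. C \<subseteq> V"
      using insert.IH insert.prems by simp
    then show ?thesis by auto
  qed auto
qed

section \<open>Counts and dimension formulas\<close>

text \<open>Used twice: for pairs of basis vectors in the upper bound and for edges meeting the
  chosen vertices in the lower bound.\<close>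

lemma card_two_subsets_meeting:
  assumes "finite A" "R \<subseteq> A"
  shows "card {e. e \<subseteq> A \<and> card e = 2 \<and> e \<inter> R \<noteq> {}}
           = (card A choose 2) - ((card A - card R) choose 2)"
proof -
  have "{e. e \<subseteq> A \<and> card e = 2 \<and> e \<inter> R \<noteq> {}}
      = {e. e \<subseteq> A \<and> card e = 2} - {e. e \<subseteq> A - R \<and> card e = 2}"
    by blast
  also have "card \<dots> = card {e. e \<subseteq> A \<and> card e = 2} - card {e. e \<subseteq> A - R \<and> card e = 2}"
    by (rule card_Diff_subset) (use assms in \<open>auto intro: rev_finite_subset[of "Pow A"]\<close>)
  also have "\<dots> = (card A choose 2) - ((card A - card R) choose 2)"
    using assms by (simp add: n_subsets card_Diff_subset finite_subset)
  finally show ?thesis .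
qed

lemma dim_coordinate_subspace:
  "dim {x :: real ^ 'm. \<forall>i. i \<notin> d \<longrightarrow> x $ i = 0} = card d"
  using dim_substandard_cart[where 'a = real and d = d] by (simp add: dim_vec_eq)

lemma dim_dissimilarity_matrices:
  "dim {M :: real ^ ('n::finite set). \<forall>e. card e \<noteq> 2 \<longrightarrow> M $ e = 0} = CARD('n) choose 2"
proof -
  have "{M :: real ^ ('n set). \<forall>e. card e \<noteq> 2 \<longrightarrow> M $ e = 0}
     = {M. \<forall>e. e \<notin> {e. card e = 2} \<longrightarrow> M $ e = 0}" by simp
  then show ?thesis
    using dim_coordinate_subspace[of "{e :: 'n set. card e = 2}"] n_subsets[of "UNIV :: 'n set" 2]
    by simp
qed

text \<open>Links the formula of the theorem to the form in which both bounds arise: pairs meeting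
  an \<open>r\<close>-set, plus \<open>r\<close>. The two inequalities control the truncated
  subtractions.\<close>

lemma choose_two_Suc_identity:
  assumes "r \<le> n"
  shows "(n + 1 choose 2) - (n + 1 - r choose 2) = (n choose 2) - (n - r choose 2) + r"
  "(n - r choose 2) \<le> (n choose 2)" "(n + 1 - r choose 2) \<le> (n + 1 choose 2)"
proof -
  show a: "(n - r choose 2) \<le> (n choose 2)" "(n + 1 - r choose 2) \<le> (n + 1 choose 2)"
    by (auto intro: binomial_right_mono)
  have "Suc n choose 2 = (n choose 2) + n" "Suc (n - r) choose 2 = (n - r choose 2) + (n - r)"
    by (simp_all add: numeral_2_eq_2)
  then show "(n + 1 choose 2) - (n + 1 - r choose 2) = (n choose 2) - (n - r choose 2) + r"
    using a assms by (simp add: Suc_diff_le)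
qed

section \<open>Decomposition into polyhedral cones\<close>

text \<open>Summing over the set \<open>e\<close> avoids ordering its two elements and makes the map
  visibly linear in the weights.\<close>

definition star_matrix :: "real ^ 'n \<Rightarrow> real ^ ('n::finite set)" where
  "star_matrix w = (\<chi> e. if card e = 2 then \<Sum>i\<in>e. w $ i else 0)"

lemma linear_star_matrix: "linear star_matrix"
  by (rule linearI) (auto simp: star_matrix_def vec_eq_iff sum.distrib sum_distrib_left)

lemma star_matrix_pair: "i \<noteq> j \<Longrightarrow> star_matrix w $ {i, j} = w $ i + w $ j"
  by (simp add: star_matrix_def)

lemma star_matrix_eq_0: "card e \<noteq> 2 \<Longrightarrow> star_matrix w $ e = 0"
  by (simp add: star_matrix_def)

lemma star_tree_matrix_iff: "star_tree_matrix M \<longleftrightarrow> (\<exists>w. M = star_matrix w)"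
proof
  assume "star_tree_matrix M"
  then obtain v where v: "dissimilarity_matrix M" "\<And>i j. i \<noteq> j \<Longrightarrow> M $ {i, j} = v $ i + v $ j"
    unfolding star_tree_matrix_def by blast
  have "M $ e = star_matrix v $ e" for e
  proof (cases "card e = 2")
    case True
    then show ?thesis by (auto simp: card_2_iff v star_matrix_pair)
  qed (use v in \<open>auto simp: dissimilarity_matrix_def star_matrix_def\<close>)
  then show "\<exists>w. M = star_matrix w" by (auto simp: vec_eq_iff)
qed (auto simp: star_tree_matrix_def dissimilarity_matrix_def star_matrix_pair star_matrix_eq_0)

text \<open>The function \<open>\<kappa>\<close> records a tree attaining the minimum at each index.
  Once it is fixed, the condition is a system of linear equations and inequalities in
  \<open>M\<close> and the weights.\<close>

lemma min_of_star_trees_iff: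
  "min_of_star_trees r M \<longleftrightarrow> (\<exists>w \<kappa>. \<forall>e. \<kappa> e < r \<and> M $ e = star_matrix (w (\<kappa> e)) $ e \<and>
     (\<forall>l<r. M $ e \<le> star_matrix (w l) $ e))" (is "?L \<longleftrightarrow> ?R")
proof
  assume ?L
  then obtain S where r: "r > 0" and S: "\<And>k. k < r \<Longrightarrow> \<exists>w. S k = star_matrix w"
    and M: "\<And>e. M $ e = Min ((\<lambda>k. S k $ e) ` {..<r})"
    unfolding min_of_star_trees_def star_tree_matrix_iff by blast
  obtain w where w: "\<And>k. k < r \<Longrightarrow> S k = star_matrix (w k)"
    using S by metis
  have "\<exists>k<r. M $ e = star_matrix (w k) $ e" for e
  proof -
    have "M $ e \<in> (\<lambda>k. S k $ e) ` {..<r}"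
      unfolding M using r by (intro Min_in) auto
    then show ?thesis using w by auto
  qed
  moreover have "M $ e \<le> star_matrix (w l) $ e" if "l < r" for e l
    unfolding M w[OF that, symmetric] using that by (intro Min_le) auto
  ultimately show ?R by metis
next
  assume ?R
  then obtain w \<kappa> where *: "\<And>e. \<kappa> e < r" "\<And>e. M $ e = star_matrix (w (\<kappa> e)) $ e"
     "\<And>e l. l < r \<Longrightarrow> M $ e \<le> star_matrix (w l) $ e"
    by blast
  have "M $ e = Min ((\<lambda>k. star_matrix (w k) $ e) ` {..<r})" for e
  proof (rule Min_eqI[symmetric])
    show "M $ e \<in> (\<lambda>k. star_matrix (w k) $ e) ` {..<r}"
      using *(1)[of e] by (subst *(2)) simp
  qed (use *(3) in auto)
  \<comment> \<open>The empty set is an index too, so \<open>\<kappa>\<close> has a value below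
    \<open>r\<close> for every \<open>n\<close>.\<close>
  moreover have "r > 0" using *(1)[of "{}"] by simp
  ultimately show ?L
    unfolding min_of_star_trees_def star_tree_matrix_iff
    by (intro conjI exI[of _ "\<lambda>k. star_matrix (w k)"]) auto
qed

lemma min_of_star_trees_imp_dissimilarity:
  "min_of_star_trees r M \<Longrightarrow> dissimilarity_matrix M"
  by (auto simp: min_of_star_trees_iff dissimilarity_matrix_def star_matrix_eq_0)

lemma min_of_star_trees_mono:
  assumes "min_of_star_trees r M" "r \<le> s"
  shows "min_of_star_trees s M"
proof -
  obtain w \<kappa> where *: "\<And>e. \<kappa> e < r" "\<And>e. M $ e = star_matrix (w (\<kappa> e)) $ e"
     "\<And>e l. l < r \<Longrightarrow> M $ e \<le> star_matrix (w l) $ e"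
    using assms(1) unfolding min_of_star_trees_iff by blast
  \<comment> \<open>The surplus trees are copies of tree 0, which leaves the minimum
    unchanged.\<close>
  define w' where "w' l = w (if l < r then l else 0)" for l
  have "r > 0" using *(1)[of "{}"] by simp
  then have "\<forall>e. \<kappa> e < s \<and> M $ e = star_matrix (w' (\<kappa> e)) $ e \<and> (\<forall>l<s. M $ e \<le> star_matrix (w' l) $ e)"
    using * assms(2) by (auto simp: w'_def intro: less_le_trans)
  then show ?thesis unfolding min_of_star_trees_iff by blast
qed

text \<open>One tree per subset of the vertices, exact at that subset and large elsewhere. This is
  wasteful, but only the existence of some number of trees is needed.\<close>

lemma dissimilarity_imp_min_of_star_trees:
  fixes M :: "real ^ ('n::finite set)"
  assumes "dissimilarity_matrix M"
  shows "min_of_star_trees CARD('n set) M"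
proof -
  obtain h where h: "bij_betw h {..<CARD('n set)} (UNIV :: 'n set set)"
    using ex_bij_betw_nat_finite[of "UNIV :: 'n set set"] by (auto simp: lessThan_atLeast0)
  define K where "K = (\<Sum>e\<in>UNIV. \<bar>M $ e\<bar>)"
  have K: "\<bar>M $ e\<bar> \<le> K" for e
    unfolding K_def by (rule member_le_sum) auto
  define w where "w l = (\<chi> i. if card (h l) = 2 \<and> i \<in> h l then M $ (h l) / 2 else 2 * K)" for l
  \<comment> \<open>A pair other than \<open>h l\<close> has an end of weight \<open>2 * K\<close>;
    with at least \<open>- K / 2\<close> at the other end the sum still exceeds the bound
    \<open>K\<close> on the entries.\<close>
  have big: "- K / 2 \<le> w l $ i" for l i
    using K[of "h l"] by (auto simp: w_def abs_le_iff)
  have le: "M $ e \<le> star_matrix (w l) $ e" for e l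
  proof (cases "card e = 2")
    case True
    show ?thesis
    proof (cases "e = h l")
      case False
      have "\<exists>i\<in>e. w l $ i = 2 * K"
      proof (rule ccontr)
        assume "\<not> ?thesis"
        then have "card (h l) = 2 \<and> e \<subseteq> h l" 
          using True by (auto simp: w_def card_2_iff split: if_splits)
        then show False using False True card_subset_eq[of "h l" e] by simp
      qed
      then obtain i j where ij: "e = {i, j}" "i \<noteq> j" "w l $ i = 2 * K"
        using True unfolding card_2_iff by (auto simp: insert_commute)
      then show ?thesis
        using big[of l j] K[of e] by (simp add: star_matrix_pair abs_le_iff)
    qed (use True in \<open>auto simp: star_matrix_def w_def\<close>)
  qed (use assms in \<open>auto simp: dissimilarity_matrix_def star_matrix_def\<close>)
  define \<kappa> where "\<kappa> = inv_into {..<CARD('n set)} h"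
  have "\<kappa> e < CARD('n set)" "h (\<kappa> e) = e" for e
    using bij_betw_inv_into[OF h] bij_betw_inv_into_right[OF h, of e]
    by (auto simp: \<kappa>_def bij_betw_def)
  moreover have "M $ e = star_matrix (w (\<kappa> e)) $ e" for e
    using \<open>h (\<kappa> e) = e\<close> assms by (auto simp: star_matrix_def w_def dissimilarity_matrix_def)
  ultimately show ?thesis
    unfolding min_of_star_trees_iff using le by (intro exI[of _ w] exI[of _ \<kappa>]) auto
qed

text \<open>The rank is attained, since some number of trees suffices, and more trees never
  hurt.\<close>

lemma rank_le_iff_min_of_star_trees:
  assumes "r > 0"
  shows "dissimilarity_matrix M \<and> star_tree_rank M \<le> r \<longleftrightarrow> min_of_star_trees r M"
proof
  assume *: "dissimilarity_matrix M \<and> star_tree_rank M \<le> r"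
  then have "min_of_star_trees (star_tree_rank M) M"
    unfolding star_tree_rank_def by (auto intro: LeastI dissimilarity_imp_min_of_star_trees)
  then show "min_of_star_trees r M"
    using * min_of_star_trees_mono by blast
next
  assume "min_of_star_trees r M"
  then show "dissimilarity_matrix M \<and> star_tree_rank M \<le> r"
    by (auto simp: star_tree_rank_def min_of_star_trees_imp_dissimilarity intro: Least_le)
qed

section \<open>Polyhedrality of the cells\<close>

lemma polyhedron_linear_ge:
  fixes f :: "'a::euclidean_space \<Rightarrow> real"
  assumes "linear f"
  shows "polyhedron {x. f x \<ge> 0}"
proof -
  have "f x = adjoint f 1 \<bullet> x" for x
    using adjoint_works[OF assms, of x 1] by (simp add: inner_commute)
  then show ?thesis by (simp add: polyhedron_halfspace_ge)
qed

text \<open>The conditions that one tree imposes on \<open>M\<close> if it attains the minimum on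
  \<open>A\<close>. Tightness is written as a second inequality, so that the system consists of
  closed half-spaces.\<close>

definition tight_cone :: "'n set set \<Rightarrow> (real ^ ('n::finite set)) set" where
  "tight_cone A = {M. \<exists>w. \<forall>e. M $ e \<le> star_matrix w $ e \<and> (e \<in> A \<longrightarrow> star_matrix w $ e \<le> M $ e)}"

text \<open>The pairs of a matrix and a weight vector satisfying the system form a polyhedral cone
  \<open>P\<close>; forgetting the weights is the linear projection \<open>fst\<close>.\<close>

lemma tight_cone: "polyhedron (tight_cone A)" "cone (tight_cone A)"
proof -
  define f where "f e p = star_matrix (snd p) $ e - fst p $ e" 
    for e and p :: "(real ^ 'a set) \<times> (real ^ 'a)"
  have lin: "linear (f e)" for e
    unfolding f_def[abs_def]
    by (rule linearI) (auto simp: linear_add[OF linear_star_matrix] linear_cmul[OF linear_star_matrix] algebra_simps)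
  define P where "P = (\<Inter>e. {p. f e p \<ge> 0}) \<inter> (\<Inter>e\<in>A. {p. 0 \<le> (\<lambda>p. - f e p) p})"
  have "polyhedron P"
    unfolding P_def
    by (intro polyhedron_Int polyhedron_Inter)
       (use polyhedron_linear_ge[OF lin] polyhedron_linear_ge[OF linear_compose_neg[OF lin]] in auto)
  moreover have cc: "convex_cone P"
    unfolding P_def convex_cone_iff
    by (auto simp: linear_0[OF lin] linear_add[OF lin] linear_cmul[OF lin] mult_nonneg_nonpos
        intro: add_nonpos_nonpos)
  moreover have eq: "tight_cone A = fst ` P"
  proof -
    have "(M, w) \<in> P \<longleftrightarrow> (\<forall>e. M $ e \<le> star_matrix w $ e \<and> (e \<in> A \<longrightarrow> star_matrix w $ e \<le> M $ e))" for M w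
      by (auto simp: P_def f_def)
    then show ?thesis
      by (simp add: tight_cone_def set_eq_iff image_iff Bex_def split_paired_Ex)
  qed
  ultimately show "polyhedron (tight_cone A)"
    using polyhedron_linear_image_cone[OF linear_fst] by simp
  show "cone (tight_cone A)"
    unfolding eq cone_def
  proof (intro ballI allI impI)
    fix M and c :: real assume "M \<in> fst ` P" "0 \<le> c"
    then obtain p where "p \<in> P" "M = fst p" by blast
    then have "c *\<^sub>R p \<in> P" "c *\<^sub>R M = fst (c *\<^sub>R p)"
      using convex_cone_scaleR[OF cc \<open>0 \<le> c\<close>] by auto
    then show "c *\<^sub>R M \<in> fst ` P" by blast
  qed
qed

text \<open>For fixed \<open>\<kappa>\<close> the trees share no unknowns, so the weights can be
  eliminated tree by tree and the cell is an intersection of one tight cone per tree.\<close>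

lemma cone_decomposition_min_of_star_trees:
  assumes "r > 0"
  shows "cone_decomposition ((\<lambda>\<kappa>. \<Inter>l<r. tight_cone {e. \<kappa> e = l}) ` {\<kappa>. \<forall>e. \<kappa> e < r})
           {M :: real ^ ('n::finite set). min_of_star_trees r M}"
proof -
  let ?K = "{\<kappa> :: 'n set \<Rightarrow> nat. \<forall>e. \<kappa> e < r}"
  have "M \<in> (\<Union>\<kappa>\<in>?K. \<Inter>l<r. tight_cone {e. \<kappa> e = l}) \<longleftrightarrow> min_of_star_trees r M" for M
  proof
    assume "M \<in> (\<Union>\<kappa>\<in>?K. \<Inter>l<r. tight_cone {e. \<kappa> e = l})"
    then obtain \<kappa> where k: "\<And>e. \<kappa> e < r" "\<And>l. l < r \<Longrightarrow> M \<in> tight_cone {e. \<kappa> e = l}" by auto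
    then have "\<forall>l. l < r \<longrightarrow> (\<exists>w. \<forall>e. M $ e \<le> star_matrix w $ e \<and> (\<kappa> e = l \<longrightarrow> star_matrix w $ e \<le> M $ e))"
      by (simp add: tight_cone_def)
    then obtain w where w: "\<forall>l. l < r \<longrightarrow> (\<forall>e. M $ e \<le> star_matrix (w l) $ e \<and> (\<kappa> e = l \<longrightarrow> star_matrix (w l) $ e \<le> M $ e))"
      unfolding choice_iff' by (elim exE)
    then show "min_of_star_trees r M"
      unfolding min_of_star_trees_iff
      by (intro exI[of _ w] exI[of _ \<kappa>]) (simp add: k(1) order_antisym)
  next
    assume "min_of_star_trees r M"
    then obtain w \<kappa> where *: "\<And>e. \<kappa> e < r" "\<And>e. M $ e = star_matrix (w (\<kappa> e)) $ e"
        "\<And>e l. l < r \<Longrightarrow> M $ e \<le> star_matrix (w l) $ e"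
      unfolding min_of_star_trees_iff by blast
    have "M \<in> tight_cone {e. \<kappa> e = l}" if "l < r" for l
      unfolding tight_cone_def using *(2,3) that by (auto intro!: exI[of _ "w l"])
    then show "M \<in> (\<Union>\<kappa>\<in>?K. \<Inter>l<r. tight_cone {e. \<kappa> e = l})"
      using *(1) by blast
  qed
  then have eq: "(\<Union>\<kappa>\<in>?K. \<Inter>l<r. tight_cone {e. \<kappa> e = l}) = {M. min_of_star_trees r M}"
    by blast
  have fin: "finite ?K"
    using finite_set_of_finite_funs[of "UNIV :: 'n set set" "{..<r}" undefined] by simp
  have ne: "(\<lambda>_. 0) \<in> ?K" using assms by simp
  have poly: "polyhedron (\<Inter>l<r. tight_cone {e. \<kappa> e = l})" for \<kappa> :: "'n set \<Rightarrow> nat"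
    by (intro polyhedron_Inter) (auto simp: tight_cone)
  have cone: "cone (\<Inter>l<r. tight_cone {e. \<kappa> e = l})" for \<kappa> :: "'n set \<Rightarrow> nat"
    using tight_cone(2) by (auto simp: cone_def)
  show ?thesis
    unfolding cone_decomposition_def
  proof (intro conjI)
    show "(\<lambda>\<kappa>. \<Inter>l<r. tight_cone {e. \<kappa> e = l}) ` ?K \<noteq> {}"
      unfolding image_is_empty using ne by (metis empty_iff)
    show "\<Union> ((\<lambda>\<kappa>. \<Inter>l<r. tight_cone {e. \<kappa> e = l}) ` ?K) = {M. min_of_star_trees r M}"
      by (rule eq)
  qed (use fin poly cone in auto)
qed

section \<open>Upper bound\<close>

text \<open>The off-diagonal part of \<open>x y^T + y x^T\<close>, written symmetrically in the
  elements of \<open>e\<close>.\<close>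

definition pair_product :: "real ^ 'n \<Rightarrow> real ^ 'n \<Rightarrow> real ^ ('n::finite set)" where
  "pair_product x y = (\<chi> e. if card e = 2
     then (\<Sum>i\<in>e. x $ i) * (\<Sum>i\<in>e. y $ i) - (\<Sum>i\<in>e. x $ i * y $ i) else 0)"

lemma pair_product_pair: "i \<noteq> j \<Longrightarrow> pair_product x y $ {i, j} = x $ i * y $ j + x $ j * y $ i"
  by (simp add: pair_product_def algebra_simps)

lemma pair_product_commute: "pair_product x y = pair_product y x"
  by (simp add: pair_product_def vec_eq_iff mult.commute)

lemma bilinear_pair_product: "bilinear pair_product"
proof -
  have "linear (\<lambda>y. pair_product x y)" for x :: "real ^ 'a"
  proof (rule linearI)
    fix y z :: "real ^ 'a" and c :: real
    show "pair_product x (y + z) = pair_product x y + pair_product x z"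
      by (simp add: pair_product_def vec_eq_iff sum.distrib distrib_left)
    show "pair_product x (c *\<^sub>R y) = c *\<^sub>R pair_product x y"
      by (simp add: pair_product_def vec_eq_iff right_diff_distrib mult.left_commute[of _ c]
          flip: sum_distrib_left)
  qed
  moreover from this have "linear (\<lambda>x. pair_product x y)" for y :: "real ^ 'a"
    by (simp only: pair_product_commute[of _ y])
  ultimately show ?thesis
    unfolding bilinear_def by blast
qed

lemma bilinear_mem_subspace:
  assumes "bilinear h" "subspace S" "\<And>b c. b \<in> A \<Longrightarrow> c \<in> B \<Longrightarrow> h b c \<in> S"
    and "x \<in> span A" "y \<in> span B"
  shows "h x y \<in> S"
proof -
  have 1: "h b y \<in> S" if "b \<in> A" for b
    using \<open>y \<in> span B\<close>
  proof (induction rule: span_induct)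
    case base
    have "linear (h b)" using assms(1) by (simp add: bilinear_def)
    from linear_subspace_vimage[OF this assms(2)] show ?case by (simp add: vimage_def)
  qed (use that assms in auto)
  show ?thesis
    using \<open>x \<in> span A\<close>
  proof (induction rule: span_induct)
    case base
    have "linear (\<lambda>x. h x y)" using assms(1) by (simp add: bilinear_def)
    from linear_subspace_vimage[OF this assms(2)] show ?case by (simp add: vimage_def)
  qed (use 1 in auto)
qed

text \<open>Enlarge a basis of the span of \<open>P\<close> to an \<open>r\<close>-element part
  \<open>R\<close> of a basis \<open>B\<close> of the whole space. The products are spanned by the
  \<open>r\<close> squares of elements of \<open>R\<close> and the mixed products of pairs from
  \<open>B\<close> that meet \<open>R\<close>.\<close>

lemma dim_pair_products_le:
  fixes P :: "(real ^ ('n::finite)) set"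
  assumes "finite P" "card P \<le> r" "r \<le> CARD('n)"
  shows "dim {pair_product x y | x y. x \<in> P} \<le> (CARD('n) choose 2) - ((CARD('n) - r) choose 2) + r"
proof -
  obtain B0 where B0: "B0 \<subseteq> P" "independent B0" "P \<subseteq> span B0"
    using maximal_independent_subset[of P] by blast
  obtain B where B: "B0 \<subseteq> B" "independent B" "UNIV \<subseteq> span B"
    using maximal_independent_subset_extend[OF _ B0(2), of UNIV] by auto
  have finB: "finite B" and cardB: "card B = CARD('n)"
    using B(2,3) independent_bound[OF B(2)] basis_card_eq_dim[of B UNIV] by auto
  have "card B0 \<le> r"
    using B0(1) assms card_mono le_trans by blast
  then obtain R where R: "B0 \<subseteq> R" "R \<subseteq> B" "card R = r"
    using exists_subset_between[of B0 r B] B(1) cardB assms(3) finB by auto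
  \<comment> \<open>Polarisation: on a pair of vectors this is twice their product, but as a
    function of the unordered pair, so that generators are counted by 2-subsets.\<close>
  define g where "g e = pair_product (\<Sum>e) (\<Sum>e) - (\<Sum>b\<in>e. pair_product b b)" 
    for e :: "(real ^ 'n) set"
  define E where "E = {e. e \<subseteq> B \<and> card e = 2 \<and> e \<inter> R \<noteq> {}}"
  define W where "W = (\<lambda>b. pair_product b b) ` R \<union> g ` E"
  have finR: "finite R" using R(2) finB finite_subset by blast
  have finE: "finite E" using finB unfolding E_def by simp
  have g: "pair_product b c = (1/2) *\<^sub>R g {b, c}" if "b \<noteq> c" for b c
    using that pair_product_commute[of c b]
    by (simp add: g_def bilinear_ladd[OF bilinear_pair_product] bilinear_radd[OF bilinear_pair_product]
      flip: scaleR_2)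
  have "pair_product b c \<in> span W" if "b \<in> R" "c \<in> B" for b c
  proof (cases "b = c")
    case False
    then have "{b, c} \<in> E" using that R(2) by (auto simp: E_def)
    then have "g {b, c} \<in> span W" by (intro span_base) (simp add: W_def)
    then show ?thesis unfolding g[OF False] by (rule span_scale)
  next
    case True
    then show ?thesis using that by (intro span_base) (simp add: W_def)
  qed
  moreover have "x \<in> span R" if "x \<in> P" for x
    using that B0(3) span_mono[OF R(1)] by blast
  ultimately have "{pair_product x y | x y. x \<in> P} \<subseteq> span W"
    using bilinear_mem_subspace[OF bilinear_pair_product subspace_span, of R B W] B(3) by blast
  then have "dim {pair_product x y | x y. x \<in> P} \<le> card W"
    using finR finE by (intro dim_le_card) (auto simp: W_def)
  also have "\<dots> \<le> card R + card E"
    unfolding W_def by (meson card_Un_le card_image_le finR finE add_mono le_trans)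
  also have "card E = (CARD('n) choose 2) - ((CARD('n) - r) choose 2)"
    unfolding E_def using card_two_subsets_meeting[OF finB R(2)] cardB R(3) by simp
  finally show ?thesis using R(3) by simp
qed

text \<open>Ties are broken in favour of the least index, which the shift by \<open>\<epsilon> l\<close> turns into strict inequalities.\<close>

lemma strict_minimizer_perturbation:
  fixes w :: "nat \<Rightarrow> real ^ ('n::finite)"
  assumes "\<And>e. \<exists>l<r. M $ e = star_matrix (w l) $ e"
    and "\<And>e l. l < r \<Longrightarrow> M $ e \<le> star_matrix (w l) $ e"
  obtains v \<kappa> where "\<And>e. \<kappa> e < r" "\<And>e. M $ e = star_matrix (w (\<kappa> e)) $ e"
    "\<And>e l. card e = 2 \<Longrightarrow> l < r \<Longrightarrow> l \<noteq> \<kappa> e \<Longrightarrow> star_matrix (v (\<kappa> e)) $ e < star_matrix (v l) $ e"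
proof -
  define \<kappa> where "\<kappa> e = (LEAST l. l < r \<and> M $ e = star_matrix (w l) $ e)" for e
  have \<kappa>: "\<kappa> e < r" "M $ e = star_matrix (w (\<kappa> e)) $ e" for e
    using LeastI_ex[OF assms(1)[of e]] by (auto simp: \<kappa>_def)
  have least: "\<kappa> e \<le> l" if "l < r" "M $ e = star_matrix (w l) $ e" for e l
    unfolding \<kappa>_def using that by (intro Least_le) auto
  \<comment> \<open>The factor 2 appears because the shift is applied at both ends of an edge. Ties
    are split by the shift; strict inequalities survive small shifts by continuity.\<close>
  have "\<forall>\<^sub>F \<epsilon> in at_right 0. star_matrix (w (\<kappa> e)) $ e + 2 * \<epsilon> * real (\<kappa> e) < star_matrix (w l) $ e + 2 * \<epsilon> * real l"
    if "l < r" "l \<noteq> \<kappa> e" for e l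
  proof (cases "M $ e = star_matrix (w l) $ e")
    case True
    then have "\<kappa> e < l" using least that by (simp add: le_neq_implies_less)
    then show ?thesis
      using True \<kappa>(2)[of e] eventually_at_right_less[of "0::real"] by (auto elim!: eventually_mono)
  next
    case False
    then have "0 < star_matrix (w l) $ e - star_matrix (w (\<kappa> e)) $ e"
      using assms(2)[OF that(1), of e] \<kappa>(2)[of e] by simp
    moreover have "((\<lambda>\<epsilon>. (star_matrix (w l) $ e + 2 * \<epsilon> * real l) - (star_matrix (w (\<kappa> e)) $ e + 2 * \<epsilon> * real (\<kappa> e)))
       \<longlongrightarrow> (star_matrix (w l) $ e + 2 * 0 * real l) - (star_matrix (w (\<kappa> e)) $ e + 2 * 0 * real (\<kappa> e))) (at_right 0)"
      by (intro tendsto_intros)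
    ultimately show ?thesis
      using order_tendstoD(1) by (fastforce elim!: eventually_mono)
  qed
  then have "\<forall>\<^sub>F \<epsilon> in at_right 0. l \<noteq> \<kappa> e \<longrightarrow>
      star_matrix (w (\<kappa> e)) $ e + 2 * \<epsilon> * real (\<kappa> e) < star_matrix (w l) $ e + 2 * \<epsilon> * real l"
    if "l < r" for e l
    using that by (cases "l = \<kappa> e") auto
  then have "\<forall>\<^sub>F \<epsilon> in at_right 0. \<forall>e\<in>UNIV. \<forall>l\<in>{..<r}. l \<noteq> \<kappa> e \<longrightarrow>
      star_matrix (w (\<kappa> e)) $ e + 2 * \<epsilon> * real (\<kappa> e) < star_matrix (w l) $ e + 2 * \<epsilon> * real l"
    by (intro eventually_ball_finite ballI) auto
  then obtain \<epsilon> :: real where \<epsilon>: "\<And>e l. l < r \<Longrightarrow> l \<noteq> \<kappa> e \<Longrightarrow>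
      star_matrix (w (\<kappa> e)) $ e + 2 * \<epsilon> * real (\<kappa> e) < star_matrix (w l) $ e + 2 * \<epsilon> * real l"
    using eventually_happens'[OF trivial_limit_at_right_real] by blast
  \<comment> \<open>Only the strict inequalities pass to the shifted weights \<open>v\<close>; the
    entries of \<open>M\<close> are still those of \<open>w\<close>.\<close>
  define v where "v l = w l + (\<chi> i. \<epsilon> * real l)" for l
  have "star_matrix (v l) $ e = star_matrix (w l) $ e + 2 * \<epsilon> * real l" if "card e = 2" for l e
    using that by (simp add: star_matrix_def v_def sum.distrib)
  then show thesis
    using \<epsilon> \<kappa> by (intro that[of \<kappa> v]) auto
qed

section \<open>Dimension of the linear space around a cell\<close>

text \<open>Keeps the equations of the cell of \<open>\<kappa>\<close> and drops the inequalities,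
  which leaves a linear space containing the cell.\<close>

definition cell_space :: "('n set \<Rightarrow> nat) \<Rightarrow> (real ^ ('n::finite set)) set" where
  "cell_space \<kappa> = {M. \<exists>w. \<forall>e. M $ e = star_matrix (w (\<kappa> e)) $ e}"

lemma subspace_cell_space: "subspace (cell_space \<kappa>)"
proof (rule subspaceI)
  show "0 \<in> cell_space \<kappa>"
    unfolding cell_space_def by (auto simp: linear_0[OF linear_star_matrix] intro!: exI[of _ "\<lambda>_. 0"])
next
  fix M N assume "M \<in> cell_space \<kappa>" "N \<in> cell_space \<kappa>"
  then obtain v w where "\<forall>e. M $ e = star_matrix (v (\<kappa> e)) $ e" "\<forall>e. N $ e = star_matrix (w (\<kappa> e)) $ e"
    unfolding cell_space_def by blast
  then show "M + N \<in> cell_space \<kappa>"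
    unfolding cell_space_def
    by (auto simp: linear_add[OF linear_star_matrix] intro!: exI[of _ "\<lambda>l. v l + w l"])
next
  fix c M assume "M \<in> cell_space \<kappa>"
  then obtain v where "\<forall>e. M $ e = star_matrix (v (\<kappa> e)) $ e"
    unfolding cell_space_def by blast
  then show "c *\<^sub>R M \<in> cell_space \<kappa>"
    unfolding cell_space_def
    by (auto simp: linear_cmul[OF linear_star_matrix] intro!: exI[of _ "\<lambda>l. c *\<^sub>R v l"])
qed

text \<open>The weights realising a matrix need not be unique; choosing them on a basis and
  extending linearly makes them linear in the matrix.\<close>

lemma cell_space_linear_section:
  obtains g where "\<And>l. linear (g l)" "\<And>x e. x \<in> cell_space \<kappa> \<Longrightarrow> x $ e = star_matrix (g (\<kappa> e) x) $ e"
proof -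
  obtain B where B: "B \<subseteq> cell_space \<kappa>" "independent B" "cell_space \<kappa> \<subseteq> span B"
    using maximal_independent_subset[of "cell_space \<kappa>"] by blast
  have "\<forall>b. b \<in> B \<longrightarrow> (\<exists>w. \<forall>e. b $ e = star_matrix (w (\<kappa> e)) $ e)"
    using B(1) unfolding cell_space_def subset_iff mem_Collect_eq .
  then obtain w where w: "\<forall>b. b \<in> B \<longrightarrow> (\<forall>e. b $ e = star_matrix (w b (\<kappa> e)) $ e)"
    unfolding choice_iff' by (elim exE)
  have "\<forall>l. \<exists>g. linear g \<and> (\<forall>b\<in>B. g b = w b l)"
    by (intro allI linear_independent_extend B(2))
  from choice[OF this] obtain g where "\<forall>l. linear (g l) \<and> (\<forall>b\<in>B. g l b = w b l)"
    by (elim exE)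
  then have g: "\<And>l. linear (g l)" "\<And>l b. b \<in> B \<Longrightarrow> g l b = w b l"
    by auto
  define f where "f x = (\<chi> e. star_matrix (g (\<kappa> e) x) $ e)" for x
  have "linear f"
    by (rule linearI) (auto simp: f_def vec_eq_iff linear_add[OF g(1)] linear_cmul[OF g(1)]
      linear_add[OF linear_star_matrix] linear_cmul[OF linear_star_matrix])
  moreover have "f b = b" if "b \<in> B" for b
  proof -
    have "f b $ e = star_matrix (w b (\<kappa> e)) $ e" for e
      by (simp add: f_def g(2)[OF that])
    then have "f b $ e = b $ e" for e
      using w[rule_format, OF that, of e] by (rule trans[OF _ sym])
    then show ?thesis by (simp add: vec_eq_iff)
  qed
  ultimately have "f x = x" if "x \<in> cell_space \<kappa>" for x
    using that B(3) by (intro linear_eq_on_span[of f "\<lambda>x. x" B x] linear_ident) auto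
  then have "x $ e = f x $ e" if "x \<in> cell_space \<kappa>" for x e
    using that by simp
  then have "x $ e = star_matrix (g (\<kappa> e) x) $ e" if "x \<in> cell_space \<kappa>" for x e
    using that unfolding f_def vec_lambda_beta .
  with g(1) show thesis by (rule that)
qed

lemma exp_neg_eventually_small:
  fixes c \<delta> :: real
  assumes "0 < c" "0 < \<delta>"
  shows "\<forall>\<^sub>F s in at_top. exp (- s * c) \<le> \<delta>"
proof -
  have "exp (- s * c) \<le> \<delta>" if "- ln \<delta> / c \<le> s" for s
  proof -
    have "- ln \<delta> \<le> s * c"
      using that assms(1) by (simp only: pos_divide_le_eq)
    then have "- s * c \<le> ln \<delta>" by simp
    then show ?thesis
      using assms(2) ln_ge_iff by blast
  qed
  then show ?thesis
    using eventually_ge_at_top by (rule eventually_mono[rotated])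
qed

text \<open>For a large finite \<open>s\<close>, the map \<open>\<Psi>\<close> embeds the cell space
  into the span of products with one factor among the \<open>r\<close> columns \<open>X l\<close>.
  In entry \<open>e\<close>, the term of tree \<open>\<kappa> e\<close> is a positive multiple of
  \<open>x $ e\<close>, and strictness makes all other terms exponentially small relative to
  it.\<close>

lemma dim_cell_space_le:
  fixes v :: "nat \<Rightarrow> real ^ ('n::finite)"
  assumes r: "r \<le> CARD('n)" and \<kappa>: "\<And>e. \<kappa> e < r"
    and strict: "\<And>e l. card e = 2 \<Longrightarrow> l < r \<Longrightarrow> l \<noteq> \<kappa> e \<Longrightarrow>
                   star_matrix (v (\<kappa> e)) $ e < star_matrix (v l) $ e"
  shows "dim (cell_space \<kappa>) \<le> (CARD('n) choose 2) - ((CARD('n) - r) choose 2) + r"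
proof -
  obtain g where lin: "\<And>l. linear (g l)"
    and g: "\<And>x e. x \<in> cell_space \<kappa> \<Longrightarrow> x $ e = star_matrix (g (\<kappa> e) x) $ e"
    by (rule cell_space_linear_section[of \<kappa>]) (rule that)
  have "\<forall>l. \<exists>K. \<forall>x. norm (star_matrix (g l x)) \<le> K * norm x"
    using linear_bounded[OF linear_compose[OF lin linear_star_matrix]] by simp
  from choice[OF this] obtain K0
    where K0: "\<forall>l x. norm (star_matrix (g l x)) \<le> K0 l * norm x" by (elim exE)
  define K where "K = 1 + (\<Sum>l<r. \<bar>K0 l\<bar>)"
  have "K > 0" unfolding K_def by (intro add_pos_nonneg sum_nonneg) auto
  have K: "\<bar>star_matrix (g l x) $ e\<bar> \<le> K * norm x" if "l < r" for l x e
  proof -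
    have "\<bar>star_matrix (g l x) $ e\<bar> \<le> norm (star_matrix (g l x))"
      by (rule component_le_norm_cart)
    also have "\<dots> \<le> K0 l * norm x" using K0 by blast
    also have "K0 l \<le> K"
      using member_le_sum[of l "{..<r}" "\<lambda>l. \<bar>K0 l\<bar>"] that by (simp add: K_def)
    finally show ?thesis by (simp add: mult_right_mono)
  qed
  have "r > 0" using \<kappa>[of "{}"] by simp
  define N where "N = real CARD('n set)"
  have "N > 0" by (simp add: N_def)
  \<comment> \<open>Chosen so that the entrywise error \<open>r * \<delta> * K * norm x\<close>,
    summed over all \<open>N\<close> indices, is half of \<open>norm x\<close>.\<close>
  define \<delta> where "\<delta> = 1 / (2 * N * real r * K)"
  have \<delta>: "\<delta> > 0" "N * (real r * (\<delta> * K)) = 1 / 2"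
    using \<open>K > 0\<close> \<open>r > 0\<close> \<open>N > 0\<close> by (auto simp: \<delta>_def)
  let ?gap = "\<lambda>e l. star_matrix (v l) $ e - star_matrix (v (\<kappa> e)) $ e"
  have "\<forall>\<^sub>F s in at_top. \<forall>e\<in>{e. card e = 2}. \<forall>l\<in>{..<r} - {\<kappa> e}. exp (- s * ?gap e l) \<le> \<delta>"
    using strict \<delta>(1)
    by (intro eventually_ball_finite ballI exp_neg_eventually_small) auto
  from eventually_happens'[OF trivial_limit_at_top_linorder this]
  obtain s where "\<forall>e\<in>{e. card e = 2}. \<forall>l\<in>{..<r} - {\<kappa> e}. exp (- s * ?gap e l) \<le> \<delta>"
    by (elim exE)
  then have s: "exp (- s * ?gap e l) \<le> \<delta>" if "card e = 2" "l < r" "l \<noteq> \<kappa> e" for e l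
    using that by blast
  define X where "X l = (\<chi> i. exp (- s * v l $ i))" for l
  define Y where "Y l x = (\<chi> i. g l x $ i * X l $ i)" for l x
  \<comment> \<open>The off-diagonal part of the differential of \<open>X X^T\<close>, in the
    direction whose columns are \<open>Y l x\<close>.\<close>
  define \<Psi> where "\<Psi> x = (\<Sum>l<r. pair_product (X l) (Y l x))" for x
  have linY: "linear (Y l)" for l
    by (rule linearI) (auto simp: Y_def vec_eq_iff linear_add[OF lin] linear_cmul[OF lin] algebra_simps)
  have "linear (\<lambda>x. pair_product (X l) (Y l x))" for l
    using linear_compose[OF linY, of "pair_product (X l)"] bilinear_pair_product
    by (auto simp: bilinear_def o_def)
  then have lin\<Psi>: "linear \<Psi>"
    unfolding \<Psi>_def[abs_def] by (intro linear_compose_sum) auto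
  have entry: "pair_product (X l) (Y l x) $ e = exp (- s * star_matrix (v l) $ e) * star_matrix (g l x) $ e" for l x e
  proof (cases "card e = 2")
    case True
    then obtain i j where "e = {i, j}" "i \<noteq> j" by (auto simp: card_2_iff)
    then show ?thesis
      by (simp add: pair_product_pair star_matrix_pair X_def Y_def algebra_simps flip: exp_add)
  qed (simp add: pair_product_def star_matrix_def)
  have ker: "x = 0" if x: "x \<in> cell_space \<kappa>" and "\<Psi> x = 0" for x
  proof (rule ccontr)
    assume "x \<noteq> 0"
    have bound: "\<bar>x $ e\<bar> \<le> real r * (\<delta> * K) * norm x" for e
    proof (cases "card e = 2")
      case True
      let ?t = "\<lambda>l. exp (- s * star_matrix (v l) $ e)" and ?G = "\<lambda>l. star_matrix (g l x) $ e"
      have "\<Psi> x $ e = (\<Sum>l<r. ?t l * ?G l)"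
        by (simp add: \<Psi>_def entry)
      then have "0 = (\<Sum>l<r. ?t l * ?G l)"
        using \<open>\<Psi> x = 0\<close> by simp
      also have "\<dots> = ?t (\<kappa> e) * ?G (\<kappa> e) + (\<Sum>l\<in>{..<r} - {\<kappa> e}. ?t l * ?G l)"
        using \<kappa> by (intro sum.remove) auto
      \<comment> \<open>Isolate the dominant term; dividing by its exponential turns the other
        exponentials into those of the gaps.\<close>
      finally have "?t (\<kappa> e) * x $ e = - (\<Sum>l\<in>{..<r} - {\<kappa> e}. ?t l * ?G l)"
        using g[OF x, of e] by simp
      then have "x $ e = - (\<Sum>l\<in>{..<r} - {\<kappa> e}. ?t l * ?G l) / ?t (\<kappa> e)"
        by (simp add: field_simps)
      also have "\<dots> = - (\<Sum>l\<in>{..<r} - {\<kappa> e}. exp (- s * ?gap e l) * ?G l)"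
        by (simp add: sum_divide_distrib exp_diff[symmetric] right_diff_distrib flip: times_divide_eq_left)
      finally have "\<bar>x $ e\<bar> \<le> (\<Sum>l\<in>{..<r} - {\<kappa> e}. \<bar>exp (- s * ?gap e l) * ?G l\<bar>)"
        by (simp only: abs_minus_cancel sum_abs)
      also have "\<dots> \<le> (\<Sum>l\<in>{..<r} - {\<kappa> e}. \<delta> * (K * norm x))"
        using s[OF True] K[of _ x e] \<delta>(1)
        by (intro sum_mono) (auto simp: abs_mult intro!: mult_mono)
      also have "\<dots> \<le> real r * (\<delta> * (K * norm x))"
        using \<delta>(1) \<open>K > 0\<close> \<kappa>[of e] by (auto simp: card_Diff_singleton_if intro!: mult_right_mono)
      finally show ?thesis by (simp add: mult_ac)
    next
      case False
      then show ?thesis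
        using g[OF x, of e] \<delta>(1) \<open>K > 0\<close> by (simp add: star_matrix_def)
    qed
    have "norm x \<le> (\<Sum>e\<in>UNIV. \<bar>x $ e\<bar>)" by (rule norm_le_l1_cart)
    also have "\<dots> \<le> (\<Sum>e\<in>(UNIV :: 'n set set). real r * (\<delta> * K) * norm x)"
      by (rule sum_mono) (rule bound)
    also have "\<dots> = N * (real r * (\<delta> * K)) * norm x" by (simp add: N_def)
    also have "\<dots> = norm x / 2" unfolding \<delta>(2) by simp
    finally show False using \<open>x \<noteq> 0\<close> by simp
  qed
  have "inj_on \<Psi> (cell_space \<kappa>)"
    unfolding linear_injective_on_subspace_0[OF lin\<Psi> subspace_cell_space] using ker by blast
  then have dim_eq: "dim (cell_space \<kappa>) = dim (\<Psi> ` cell_space \<kappa>)"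
    by (intro dim_image_eq[symmetric] lin\<Psi>) (simp add: span_eq_iff[THEN iffD2, OF subspace_cell_space])
  have "\<Psi> ` cell_space \<kappa> \<subseteq> span {pair_product x y | x y. x \<in> X ` {..<r}}"
  proof (unfold \<Psi>_def, intro image_subsetI span_sum span_base CollectI)
    fix x l assume "l \<in> {..<r}"
    then show "\<exists>x' y. pair_product (X l) (Y l x) = pair_product x' y \<and> x' \<in> X ` {..<r}"
      by (intro exI[of _ "X l"] exI[of _ "Y l x"]) simp
  qed
  from dim_subset[OF this] have "dim (\<Psi> ` cell_space \<kappa>) \<le> dim {pair_product x y | x y. x \<in> X ` {..<r}}"
    by (simp only: dim_span)
  also have "\<dots> \<le> (CARD('n) choose 2) - ((CARD('n) - r) choose 2) + r"
    using card_image_le[of "{..<r}" X] by (intro dim_pair_products_le r) auto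
  finally show ?thesis unfolding dim_eq .
qed

lemma dim_cell_space_le_choose_two:
  "dim (cell_space \<kappa> :: (real ^ ('n::finite set)) set) \<le> CARD('n) choose 2"
proof -
  have "cell_space \<kappa> \<subseteq> {M :: real ^ ('n set). \<forall>e. card e \<noteq> 2 \<longrightarrow> M $ e = 0}"
    by (auto simp: cell_space_def star_matrix_def)
  from dim_subset[OF this] show ?thesis
    unfolding dim_dissimilarity_matrices .
qed

text \<open>Breaking ties puts each matrix in one of finitely many cell spaces of small dimension,
  and a convex set covered by these lies in a single one. Any convex \<open>C\<close> is allowed
  because the theorem concerns every decomposition.\<close>

lemma aff_dim_le_of_convex:
  fixes C :: "(real ^ ('n::finite set)) set"
  assumes "convex C" "C \<subseteq> {M. min_of_star_trees r M}" "r \<le> CARD('n)"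
  shows "aff_dim C \<le> int (min ((CARD('n) choose 2) - ((CARD('n) - r) choose 2) + r) (CARD('n) choose 2))"
    (is "_ \<le> int ?d")
proof (cases "C = {}")
  case False
  let ?K = "{\<kappa> :: 'n set \<Rightarrow> nat. (\<forall>e. \<kappa> e < r) \<and> dim (cell_space \<kappa>) \<le> ?d}"
  have "finite {\<kappa> :: 'n set \<Rightarrow> nat. \<forall>e. \<kappa> e < r}"
    using finite_set_of_finite_funs[of "UNIV :: 'n set set" "{..<r}" undefined] by simp
  then have "finite ?K"
    by (rule rev_finite_subset) auto
  have "\<exists>\<kappa>\<in>?K. M \<in> cell_space \<kappa>" if "M \<in> C" for M
  proof -
    have "min_of_star_trees r M" using assms(2) that by blast
    then obtain w \<kappa>0 where *: "\<And>e. \<kappa>0 e < r" "\<And>e. M $ e = star_matrix (w (\<kappa>0 e)) $ e"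
      "\<And>e l. l < r \<Longrightarrow> M $ e \<le> star_matrix (w l) $ e"
      unfolding min_of_star_trees_iff by blast
    then have "\<exists>l<r. M $ e = star_matrix (w l) $ e" for e by blast
    then obtain v \<kappa> where \<kappa>: "\<And>e. \<kappa> e < r" "\<And>e. M $ e = star_matrix (w (\<kappa> e)) $ e"
      "\<And>e l. card e = 2 \<Longrightarrow> l < r \<Longrightarrow> l \<noteq> \<kappa> e \<Longrightarrow> star_matrix (v (\<kappa> e)) $ e < star_matrix (v l) $ e"
      using *(3) by (rule strict_minimizer_perturbation) blast+
    have "dim (cell_space \<kappa>) \<le> ?d"
      using dim_cell_space_le[OF assms(3) \<kappa>(1,3)] dim_cell_space_le_choose_two[of \<kappa>] by simp
    moreover have "M \<in> cell_space \<kappa>"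
      using \<kappa>(2) unfolding cell_space_def by (intro CollectI exI[of _ w] allI)
    ultimately show ?thesis using \<kappa>(1) by blast
  qed
  then have cover: "C \<subseteq> \<Union> (cell_space ` ?K)" by blast
  have "\<exists>V\<in>cell_space ` ?K. C \<subseteq> V"
  proof (rule convex_subset_finite_Union_affine[OF finite_imageI assms(1) False cover])
    show "finite ?K" by fact
    show "affine V" if "V \<in> cell_space ` ?K" for V
      using that by (elim imageE) (simp only: subspace_cell_space subspace_imp_affine)
  qed
  then obtain \<kappa> where "C \<subseteq> cell_space \<kappa>" "dim (cell_space \<kappa>) \<le> ?d" by blast
  then have "aff_dim C \<le> int (dim (cell_space \<kappa>))"
    by (metis aff_dim_subset aff_dim_subspace subspace_cell_space)
  also have "\<dots> \<le> int ?d" using \<open>dim (cell_space \<kappa>) \<le> ?d\<close> by (rule of_nat_mono)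
  finally show ?thesis .
qed simp

section \<open>Lower bound\<close>

text \<open>The matrices in question, projected to the coordinates in \<open>E\<close>, contain a
  box around \<open>N\<close>; their other entries are left free.\<close>

definition locally_covers :: "nat \<Rightarrow> 'n set set \<Rightarrow> real ^ ('n::finite set) \<Rightarrow> real \<Rightarrow> bool" where
  "locally_covers r E N \<epsilon> \<longleftrightarrow> (\<forall>y. (\<forall>e. \<bar>y $ e\<bar> \<le> \<epsilon>) \<longrightarrow>
     (\<exists>M. min_of_star_trees r M \<and> (\<forall>e\<in>E. M $ e = N $ e + y $ e)))"

text \<open>Perturbing the trees \<open>v l\<close> by \<open>u y l\<close> moves the winning entry
  by at most 1/6 and any other by at most 5/12 + 5/12 = 5/6. Together this does not exceed the gap
  1, so the same tree still attains the minimum.\<close>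

lemma locally_covers_if_gap:
  fixes v :: "nat \<Rightarrow> real ^ ('n::finite)" and u :: "real ^ ('n set) \<Rightarrow> nat \<Rightarrow> real ^ 'n"
  assumes "r > 0"
    and small: "\<And>y l i. \<lbrakk>\<forall>e. \<bar>y $ e\<bar> \<le> 1 / 6; l < r\<rbrakk> \<Longrightarrow> \<bar>u y l $ i\<bar> \<le> 5 / 12"
    and gap: "\<And>e. e \<in> E \<Longrightarrow> \<exists>k<r. (\<forall>y. star_matrix (u y k) $ e = y $ e) \<and>
      (\<forall>l<r. l \<noteq> k \<longrightarrow> star_matrix (v k) $ e + 1 \<le> star_matrix (v l) $ e)"
  shows "\<exists>N. locally_covers r E N (1 / 6)"
proof -
  define N :: "real ^ ('n set)" where "N = (\<chi> e. Min ((\<lambda>l. star_matrix (v l) $ e) ` {..<r}))"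
  have "\<exists>M. min_of_star_trees r M \<and> (\<forall>e\<in>E. M $ e = N $ e + y $ e)" if y: "\<forall>e. \<bar>y $ e\<bar> \<le> 1 / 6" for y
  proof (intro exI conjI ballI)
    define M :: "real ^ ('n set)" where "M = (\<chi> e. Min ((\<lambda>l. star_matrix (v l + u y l) $ e) ` {..<r}))"
    show "min_of_star_trees r M"
      unfolding min_of_star_trees_def star_tree_matrix_iff M_def using \<open>r > 0\<close>
      by (auto intro!: exI[of _ "\<lambda>l. star_matrix (v l + u y l)"])
    fix e assume "e \<in> E"
    then obtain k where k: "k < r" "star_matrix (u y k) $ e = y $ e"
      and gap_k: "\<And>l. l < r \<Longrightarrow> l \<noteq> k \<Longrightarrow> star_matrix (v k) $ e + 1 \<le> star_matrix (v l) $ e"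
      using gap by blast
    have N: "N $ e = star_matrix (v k) $ e"
      unfolding N_def vec_lambda_beta using k(1) gap_k by (intro Min_eqI) force+
    have split: "star_matrix (v l + u y l) $ e = star_matrix (v l) $ e + star_matrix (u y l) $ e" for l
      by (simp add: linear_add[OF linear_star_matrix])
    have "\<bar>star_matrix (u y l) $ e\<bar> \<le> 5 / 6" if "l < r" for l
    proof (cases "card e = 2")
      case True
      then obtain i j where "e = {i, j}" "i \<noteq> j" by (auto simp: card_2_iff)
      then show ?thesis
        using small[OF y that, of i] small[OF y that, of j] abs_triangle_ineq[of "u y l $ i" "u y l $ j"]
        by (simp add: star_matrix_pair)
    qed (simp add: star_matrix_def)
    then have "star_matrix (v k + u y k) $ e \<le> star_matrix (v l + u y l) $ e" if "l < r" for l
      using gap_k[OF that] that k(2) y[rule_format, of e] unfolding split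
      by (cases "l = k") (fastforce simp: abs_le_iff)+
    then have "M $ e = star_matrix (v k + u y k) $ e"
      unfolding M_def vec_lambda_beta using k(1) by (intro Min_eqI) auto
    then show "M $ e = N $ e + y $ e"
      unfolding split N k(2) .
  qed
  then show ?thesis unfolding locally_covers_def by blast
qed

text \<open>Cell \<open>k\<close> contains the star at \<open>h k\<close>, up to edges that belong to an earlier star, and one further
  edge \<open>f k\<close> that closes an odd cycle with it; hence the matrix entries in the cell are independent
  coordinates for the \<open>k\<close>-th tree.\<close>

lemma locally_covers_stars:
  fixes R :: "'n::finite set" and f :: "nat \<Rightarrow> 'n set"
  assumes "r > 0" and h: "bij_betw h {..<r} R"
    and f: "\<And>l. l < r \<Longrightarrow> f l \<inter> R = {}" "\<And>l. l < r \<Longrightarrow> f l = {} \<or> card (f l) = 2"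
    and inj: "\<And>k l. \<lbrakk>k < r; l < r; k \<noteq> l; f k \<noteq> {}\<rbrakk> \<Longrightarrow> f k \<noteq> f l"
  shows "\<exists>N. locally_covers r ({e. card e = 2 \<and> e \<inter> R \<noteq> {}} \<union> (f ` {..<r} - {{}})) N (1 / 6)"
proof (rule locally_covers_if_gap[OF \<open>r > 0\<close>])
  define idx where "idx = inv_into {..<r} h"
  have hR: "h l \<in> R" and idx_h: "idx (h l) = l" if "l < r" for l
    using h that by (auto simp: bij_betw_def idx_def inv_into_f_f)
  have idx: "idx i < r" "h (idx i) = i" if "i \<in> R" for i
    using that bij_betw_inv_into[OF h] bij_betw_inv_into_right[OF h] by (auto simp: idx_def bij_betw_def)
  \<comment> \<open>A star edge costs at most 10 in its own tree. In other trees it costs at least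
    19, or 11 = 0 + 11 in the tree of a later centre at its other end; the value 11 is what assigns
    edges between centres to the earlier one. An extra edge costs 18 = 9 + 9 in its own tree and at
    least 19 in the others.\<close>
  define v :: "nat \<Rightarrow> real ^ 'n" where
    "v l = (\<chi> i. if i \<in> R then if idx i = l then 0 else if idx i < l then 11 else 10
                 else if i \<in> f l then 9 else 10)" for l
  \<comment> \<open>Prescribing \<open>y\<close> on the star leaves the centre weight
    \<open>a\<close> free; for \<open>f l = {i, j}\<close> the extra edge then requires
    \<open>y $ {h l, i} + y $ {h l, j} - 2 * a = y $ f l\<close>. If \<open>f l\<close> is empty,
    the formula merely gives some small value.\<close>
  define a :: "real ^ ('n set) \<Rightarrow> nat \<Rightarrow> real" where
    "a y l = ((\<Sum>i\<in>f l. y $ {h l, i}) - y $ f l) / 2" for y l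
  define u :: "real ^ ('n set) \<Rightarrow> nat \<Rightarrow> real ^ 'n" where
    "u y l = (\<chi> i. if i = h l then a y l else y $ {h l, i} - a y l)" for y l
  show "\<bar>u y l $ i\<bar> \<le> 5 / 12" if y: "\<forall>e. \<bar>y $ e\<bar> \<le> 1 / 6" and "l < r" for y l i
  proof -
    have "\<bar>\<Sum>i\<in>f l. y $ {h l, i}\<bar> \<le> real (card (f l)) * (1 / 6)"
      using y by (intro order_trans[OF sum_abs] sum_bounded_above) auto
    also have "\<dots> \<le> 2 * (1 / 6)"
      using f(2)[OF \<open>l < r\<close>] by auto
    \<comment> \<open>Half of 2/6 + 1/6; adding 1/6 for a star entry gives 5/12.\<close>
    finally have "\<bar>a y l\<bar> \<le> 1 / 4"
      using y[rule_format, of "f l"] abs_triangle_ineq4[of "\<Sum>i\<in>f l. y $ {h l, i}" "y $ f l"]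
      by (simp add: a_def)
    then show ?thesis
      using y[rule_format, of "{h l, i}"] abs_triangle_ineq4[of "y $ {h l, i}" "a y l"] by (simp add: u_def)
  qed
  fix e assume "e \<in> {e. card e = 2 \<and> e \<inter> R \<noteq> {}} \<union> (f ` {..<r} - {{}})"
  then consider (star) "card e = 2" "e \<inter> R \<noteq> {}" | (extra) k where "k < r" "e = f k" "f k \<noteq> {}"
    by blast
  then show "\<exists>k<r. (\<forall>y. star_matrix (u y k) $ e = y $ e) \<and>
      (\<forall>l<r. l \<noteq> k \<longrightarrow> star_matrix (v k) $ e + 1 \<le> star_matrix (v l) $ e)"
  proof cases
    case star
    \<comment> \<open>Orient the edge so that \<open>i\<close> is its centre, the earlier one if
      both ends are centres.\<close>
    obtain i j where e: "e = {i, j}" "i \<noteq> j" "i \<in> R" "j \<in> R \<Longrightarrow> idx i < idx j"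
    proof -
      obtain p q where pq: "e = {p, q}" "p \<noteq> q" "p \<in> R"
        using star by (auto simp: card_2_iff insert_commute)
      show thesis
      proof (cases "q \<in> R \<and> idx q < idx p")
        case True
        then show thesis using pq by (intro that[of q p]) auto
      next
        case False
        moreover have "q \<in> R \<Longrightarrow> idx q \<noteq> idx p" using idx(2) pq by metis
        ultimately show thesis using pq by (intro that[of p q]) auto
      qed
    qed
    show ?thesis
    proof (intro exI[of _ "idx i"] conjI allI impI)
      show "idx i < r" using e idx by blast
      show "star_matrix (u y (idx i)) $ e = y $ e" for y
        using e idx(2) by (simp add: star_matrix_pair u_def)
      show "star_matrix (v (idx i)) $ e + 1 \<le> star_matrix (v l) $ e" if "l \<noteq> idx i" for l
        using e that by (auto simp: star_matrix_pair v_def)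
    qed
  next
    case (extra k)
    obtain i j where ij: "f k = {i, j}" "i \<noteq> j"
      using f(2)[OF extra(1)] extra(3) by (auto simp: card_2_iff)
    then have R: "i \<notin> R" "j \<notin> R" using f(1)[OF extra(1)] by auto
    show ?thesis
    proof (intro exI[of _ k] conjI allI impI)
      show "k < r" by fact
      show "star_matrix (u y k) $ e = y $ e" for y
        using ij R hR[OF extra(1)] extra(2) by (auto simp: star_matrix_pair u_def a_def)
      show "star_matrix (v k) $ e + 1 \<le> star_matrix (v l) $ e" if l: "l < r" "l \<noteq> k" for l
      proof -
        \<comment> \<open>Distinct extra edges share at most one end, so in tree \<open>l\<close>
          some end of \<open>e\<close> weighs 10 instead of 9.\<close>
        have "\<not> (i \<in> f l \<and> j \<in> f l)"
        proof
          assume "i \<in> f l \<and> j \<in> f l"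
          then have "{i, j} \<subseteq> f l" "card (f l) = 2" using f(2)[OF l(1)] by auto
          then have "f k = f l"
            using card_subset_eq[of "f l" "{i, j}"] ij by simp
          then show False using inj[OF extra(1) l(1)] l(2) extra(3) by simp
        qed
        then show ?thesis
          using ij R extra(2) by (auto simp: star_matrix_pair v_def)
      qed
    qed
  qed
qed

lemma large_locally_covered_set:
  assumes "0 < r" "r \<le> CARD('n::finite)"
  obtains E :: "('n::finite) set set" and N where "locally_covers r E N (1 / 6)"
    "card E = min ((CARD('n) choose 2) - ((CARD('n) - r) choose 2) + r) (CARD('n) choose 2)"
proof -
  obtain R :: "'n set" where R: "card R = r"
    using obtain_subset_with_card_n[OF assms(2)] by blast
  obtain h where h: "bij_betw h {..<r} R"
    using ex_bij_betw_nat_finite[of R] R by (auto simp: lessThan_atLeast0)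
  define T where "T = {e. e \<subseteq> - R \<and> card e = 2}"
  have cardT: "card T = (CARD('n) - r) choose 2"
    unfolding T_def using n_subsets[of "- R" 2] R by (simp add: Compl_eq_Diff_UNIV card_Diff_subset)
  \<comment> \<open>Either every tree gets its own extra edge, or the edges avoiding
    \<open>R\<close> run out and \<open>E\<close> consists of all pairs; this is the source of the
    minimum in the formula.\<close>
  define q where "q = min r (card T)"
  obtain T' where T': "T' \<subseteq> T" "card T' = q" "finite T'"
    using obtain_subset_with_card_n[of q T] by (auto simp: q_def)
  obtain g where g: "bij_betw g {..<q} T'"
    using ex_bij_betw_nat_finite[OF T'(3)] T'(2) by (auto simp: lessThan_atLeast0)
  define f where "f l = (if l < q then g l else {})" for l
  have gT: "g l \<in> T" if "l < q" for l
    using g T'(1) that by (auto simp: bij_betw_def)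
  have gne: "g l \<noteq> {}" if "l < q" for l
    using gT[OF that] by (auto simp: T_def)
  define S where "S = {e :: 'n set. card e = 2 \<and> e \<inter> R \<noteq> {}}"
  have "f ` {..<r} - {{}} = g ` {..<q}"
    using gne by (force simp: f_def q_def split: if_splits)
  also have "\<dots> = T'" using g by (simp add: bij_betw_def)
  finally have fT: "f ` {..<r} - {{}} = T'" .
  have "\<exists>N. locally_covers r (S \<union> (f ` {..<r} - {{}})) N (1 / 6)"
    unfolding S_def
  proof (rule locally_covers_stars[OF assms(1) h])
    show "f l \<inter> R = {}" for l using gT[of l] by (auto simp: f_def T_def)
    show "f l = {} \<or> card (f l) = 2" for l using gT[of l] by (auto simp: f_def T_def)
    show "f k \<noteq> f l" if "k \<noteq> l" "f k \<noteq> {}" for k l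
      using that g gne[of l] by (auto simp: f_def bij_betw_def inj_on_def split: if_splits)
  qed
  then obtain N where N: "locally_covers r (S \<union> T') N (1 / 6)"
    unfolding fT by blast
  have "card (S \<union> T') = card S + card T'"
    using T'(1) by (intro card_Un_disjoint) (auto simp: S_def T_def)
  also have "card S = (CARD('n) choose 2) - ((CARD('n) - r) choose 2)"
    using card_two_subsets_meeting[of UNIV R] R by (simp add: S_def)
  finally have "card (S \<union> T') = min ((CARD('n) choose 2) - ((CARD('n) - r) choose 2) + r) (CARD('n) choose 2)"
    using choose_two_Suc_identity(2)[OF assms(2)] unfolding T'(2) q_def cardT by linarith
  with N show thesis by (rule that)
qed

text \<open>Project to the coordinates in \<open>E\<close>. The covered box lies in the union of the
  projected affine hulls of members of \<open>F\<close>, hence in one of them, and projecting does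
  not raise dimension.\<close>

lemma aff_dim_ge_of_locally_covers:
  fixes F :: "(real ^ ('n::finite set)) set set" and E :: "'n set set"
  assumes "locally_covers r E N \<epsilon>" "\<epsilon> > 0" "finite F" "{M. min_of_star_trees r M} \<subseteq> \<Union>F"
  shows "\<exists>C\<in>F. int (card E) \<le> aff_dim C"
proof -
  define \<pi> :: "real ^ ('n set) \<Rightarrow> real ^ ('n set)" where "\<pi> M = (\<chi> e. if e \<in> E then M $ e else 0)" for M
  have lin: "linear \<pi>"
    by (rule linearI) (auto simp: \<pi>_def vec_eq_iff)
  define Q :: "(real ^ ('n set)) set" where "Q = cbox (\<chi> e. - \<epsilon>) (\<chi> e. \<epsilon>)"
  have Q: "y \<in> Q \<longleftrightarrow> (\<forall>e. \<bar>y $ e\<bar> \<le> \<epsilon>)" for y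
    by (auto simp: Q_def mem_box_cart abs_le_iff minus_le_iff)
  define K where "K = (+) (\<pi> N) ` \<pi> ` Q"
  have "convex K"
    unfolding K_def Q_def by (intro convex_translation convex_linear_image lin convex_box)
  moreover have "K \<noteq> {}"
    using Q[of 0] \<open>\<epsilon> > 0\<close> by (auto simp: K_def)
  moreover have "K \<subseteq> \<Union> ((\<lambda>C. \<pi> ` (affine hull C)) ` F)"
  proof
    fix z assume "z \<in> K"
    then obtain y where y: "y \<in> Q" "z = \<pi> N + \<pi> y" by (auto simp: K_def)
    then obtain M where M: "min_of_star_trees r M" "\<forall>e\<in>E. M $ e = N $ e + y $ e"
      using assms(1) Q[of y] unfolding locally_covers_def by blast
    then have "z = \<pi> M" by (simp add: y \<pi>_def vec_eq_iff)
    moreover obtain C where "C \<in> F" "M \<in> C" using M(1) assms(4) by blast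
    ultimately show "z \<in> \<Union> ((\<lambda>C. \<pi> ` (affine hull C)) ` F)"
      by (simp only:) (intro UN_I imageI hull_inc)
  qed
  moreover have "affine V" if "V \<in> (\<lambda>C. \<pi> ` (affine hull C)) ` F" for V
    using that by (elim imageE) (simp only: affine_affine_hull affine_hull_linear_image linear_conv_bounded_linear[THEN iffD1, OF lin])
  ultimately have "\<exists>V\<in>(\<lambda>C. \<pi> ` (affine hull C)) ` F. K \<subseteq> V"
    by (rule convex_subset_finite_Union_affine[OF finite_imageI[OF \<open>finite F\<close>]])
  then obtain C where C: "C \<in> F" "K \<subseteq> \<pi> ` (affine hull C)" by blast
  \<comment> \<open>Any vector supported on \<open>E\<close> can be scaled into the box, so the
    projected box spans this whole coordinate subspace.\<close>
  have sub: "{x. \<forall>e. e \<notin> E \<longrightarrow> x $ e = 0} \<subseteq> span (\<pi> ` Q)"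
  proof
    fix x :: "real ^ ('n set)" assume x: "x \<in> {x. \<forall>e. e \<notin> E \<longrightarrow> x $ e = 0}"
    define c where "c = \<epsilon> / (norm x + 1)"
    have "c > 0" using \<open>\<epsilon> > 0\<close> by (simp add: c_def add_nonneg_pos)
    have "\<bar>(c *\<^sub>R x) $ e\<bar> \<le> \<epsilon>" for e
    proof -
      have "\<bar>x $ e\<bar> \<le> norm x + 1" using component_le_norm_cart[of x e] by simp
      then have "c * \<bar>x $ e\<bar> \<le> c * (norm x + 1)" using \<open>c > 0\<close> by (intro mult_left_mono) auto
      also have "\<dots> = \<epsilon>" by (simp add: c_def add_nonneg_eq_0_iff)
      finally show ?thesis using \<open>c > 0\<close> by (simp add: abs_mult)
    qed
    then have "\<pi> (c *\<^sub>R x) \<in> span (\<pi> ` Q)" using Q by (intro span_base imageI) blast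
    moreover have "\<pi> (c *\<^sub>R x) = c *\<^sub>R x" using x by (simp add: \<pi>_def vec_eq_iff)
    ultimately have "inverse c *\<^sub>R (c *\<^sub>R x) \<in> span (\<pi> ` Q)" by (simp only: span_scale)
    then show "x \<in> span (\<pi> ` Q)" using \<open>c > 0\<close> by simp
  qed
  have zero: "0 \<in> \<pi> ` Q"
    using Q[of 0] \<open>\<epsilon> > 0\<close> by (intro image_eqI[of _ _ 0]) (auto simp: linear_0[OF lin])
  from dim_subset[OF sub] have "int (card E) \<le> int (dim (\<pi> ` Q))"
    by (simp only: dim_span dim_coordinate_subspace of_nat_le_iff)
  also have "int (dim (\<pi> ` Q)) = aff_dim K"
    unfolding K_def aff_dim_translation_eq by (intro aff_dim_zero[symmetric] hull_inc zero)
  also have "\<dots> \<le> aff_dim (\<pi> ` (affine hull C))" using C(2) by (rule aff_dim_subset)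
  also have "\<dots> \<le> aff_dim (affine hull C)" by (rule aff_dim_linear_image_le[OF lin])
  finally show ?thesis using C(1) by auto
qed

section \<open>Both bounds combined for an arbitrary decomposition\<close>

theorem theorem4p7:
  fixes r n :: nat
  assumes "r > 0" and "n = CARD('n::finite)"
  shows "has_cone_dimension
           {M :: real ^ ('n set). dissimilarity_matrix M \<and> star_tree_rank M \<le> r}
           (min (int ((n + 1) choose 2) - int ((n + 1 - r) choose 2)) (int (n choose 2)))"
proof -
  \<comment> \<open>Both bounds are stated for at most \<open>n\<close> trees. For
    \<open>r > n\<close> the value is already \<open>n choose 2\<close>: the ambient space gives the
    upper bound, and the lower bound with \<open>n\<close> trees carries over to \<open>r\<close> by
    monotonicity.\<close>
  define s where "s = min r n"
  have s: "0 < s" "s \<le> CARD('n)" "s \<le> r"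
    using assms zero_less_card_finite by (auto simp: s_def)
  define d where "d = min ((n choose 2) - ((n - s) choose 2) + s) (n choose 2)"
  have d: "min (int ((n + 1) choose 2) - int ((n + 1 - r) choose 2)) (int (n choose 2)) = int d"
  proof (cases "r \<le> n")
    case True
    then show ?thesis
      using choose_two_Suc_identity[OF True] by (simp add: d_def s_def of_nat_min flip: of_nat_diff)
  next
    case False
    \<comment> \<open>The subtracted binomial vanishes, and the second argument of the minimum is
      the smaller one.\<close>
    then have "n + 1 - r = 0" by simp
    moreover have "(n + 1) choose 2 \<ge> n choose 2" by (rule binomial_right_mono) simp
    ultimately show ?thesis
      using False by (simp add: d_def s_def binomial_eq_0 of_nat_min)
  qed
  let ?X = "{M :: real ^ ('n set). min_of_star_trees r M}"
  have X: "{M :: real ^ ('n set). dissimilarity_matrix M \<and> star_tree_rank M \<le> r} = ?X"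
    by (simp only: rank_le_iff_min_of_star_trees[OF assms(1)])
  have "Max (aff_dim ` F) = int d" if F: "cone_decomposition F ?X" for F
  proof -
    have fin: "finite F" and cover: "\<Union>F = ?X" and convex: "\<And>C. C \<in> F \<Longrightarrow> convex C"
      using F unfolding cone_decomposition_def by (blast intro: polyhedron_imp_convex)+
    have upper: "aff_dim C \<le> int d" if "C \<in> F" for C
    proof (cases "r \<le> n")
      case True
      have "C \<subseteq> ?X" using that cover by blast
      from aff_dim_le_of_convex[OF convex[OF that] this True[unfolded assms(2)]] show ?thesis
        using True unfolding d_def s_def assms(2) by (simp only: min_absorb1)
    next
      case False
      have "C \<subseteq> {M. \<forall>e. card e \<noteq> 2 \<longrightarrow> M $ e = 0}"
        using that cover min_of_star_trees_imp_dissimilarity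
        unfolding dissimilarity_matrix_def by blast
      moreover have "subspace {M :: real ^ ('n set). \<forall>e. card e \<noteq> 2 \<longrightarrow> M $ e = 0}"
        by (auto simp: subspace_def)
      ultimately have "aff_dim C \<le> int (n choose 2)"
        using aff_dim_subset[of C] unfolding assms(2) dim_dissimilarity_matrices[symmetric]
        by (simp only: aff_dim_subspace[symmetric])
      then show ?thesis using False by (simp add: d_def s_def binomial_eq_0)
    qed
    obtain E :: "'n set set" and N where E: "locally_covers s E N (1 / 6)" "card E = d"
      by (rule large_locally_covered_set[OF s(1,2)]) (auto simp: d_def assms(2) intro: that)
    have "{M :: real ^ ('n set). min_of_star_trees s M} \<subseteq> \<Union>F"
      unfolding cover using min_of_star_trees_mono[OF _ s(3)] by blast
    then obtain C where "C \<in> F" "int d \<le> aff_dim C"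
      using aff_dim_ge_of_locally_covers[OF E(1) _ fin] E(2) by auto
    then have "int d \<in> aff_dim ` F"
      using upper[of C] by (intro image_eqI[of _ _ C]) simp_all
    then show ?thesis
      using fin upper by (intro Max_eqI) auto
  qed
  then show ?thesis
    unfolding has_cone_dimension_def X d
    using cone_decomposition_min_of_star_trees[OF assms(1)] by blast
qed

end
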